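(* Let $\mathcal I$ be a nonempty index set, let $\mathbf A$ be a locally finite quantifier theory, and for each $i\in\mathcal I$ let $\mathbf B_i$ be a $2$-model of $\mathbf A$. Let $\mathbf B$ be the modification of $\mathbf A$ with $\mathbf B_*(\emptyset)=\prod_{i\in\mathcal I}2$ and $\mathbf B^*(\emptyset)=\prod_{i\in\mathcal I}\mathbf B_i^*(\emptyset)$, such that for nonempty $X\in\mathcal S$, $a\in\mathbf A^*(X)$, $p\in\mathbf A_*(X)$ and $\sigma:X\to\mathbf B^*(\emptyset)$ one has $(a\sigma)(i)=a\sigma_i$ and $(p\sigma)(i)=p\sigma_i$, where $\sigma_i:X\to\mathbf B_i^*(\emptyset)$ is given by $\sigma_i(x)=\sigma(x)(i)$. Then: (a) $\mathbf B$ is a model of $\mathbf A$. (b) If $I$ is an ultrafilter of $\mathbf B_*(\emptyset)=\prod_{i\in\mathcal I}2$, then $\mathbf B/I$ is a $2$-model of $\mathbf A$.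
   Context: Throughout, $\mathcal S$ is a nonempty collection of sets containing at least one infinite set; $X,Y,Z,W$ denote members of $\mathcal S$ (sets of variables). Quantifier theory. A quantifier theory $\mathbf A$ over $\mathcal S$ consists of: a set $\mathbf A^*(X)$ and a map $\epsilon_X:X\to\mathbf A^*(X)$ for each $X$ (one writes $x$ for $\epsilon_X(x)$); a Boolean algebra $\mathbf A_*(X)$ for each $X$; an element $a\sigma\in\mathbf A^*(Y)$ for each nonempty $X$, $a\in\mathbf A^*(X)$ and map $\sigma:X\to\mathbf A^*(Y)$; an element $p\sigma\in\mathbf A_*(Y)$ for each nonempty $X$, $p\in\mathbf A_*(X)$ and map $\sigma:X\to\mathbf A^*(Y)$; an element $\forall x.p\in\mathbf A_*(X)$ for each nonempty $X$, $x\in X$, $p\in\mathbf A_*(X)$. Put $\mathbf A(X)=\mathbf A_*(X)\cup\mathbf A^*(X)$. For all nonempty $X$, $x\in X$, $t\in\mathbf A(X)$, $\sigma:X\to\mathbf A^*(Y)$, $p,q\in\mathbf A_*(X)$ the following hold. (P1) $t\epsilon_X=t$. (P2) $(t\sigma)\tau=t(\sigma\tau)$ if $Y$ is nonempty and $\tau:Y\to\mathbf A^*(W)$, where $(\sigma\tau)(x)=\sigma(x)\tau$. (P3) $x\sigma=\sigma(x)$. (P4) $p\mapsto p\sigma$ is a homomorphism of Boolean algebras $\mathbf A_*(X)\to\mathbf A_*(Y)$. (P5) $(\forall x.p)\sigma=\forall y.(p\sigma^{y/x})$ whenever $y,z\in Y$, $y\ne z$ and $\sigma[z/y]=\sigma$.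 (Q1) $\forall x.(p\wedge q)=\forall x.p\wedge\forall x.q$. (Q2) $\forall x.p\le p$. (Q3) $\forall x.p=p$ if $p[y/x]=p$ for some $y\in X$, $y\neq x$. Notation: for $y\in Y$ and $d\in\mathbf A^*(Y)$, $[d/y]:Y\to\mathbf A^*(Y)$ sends $y$ to $d$ and every other variable to itself; for $d\in \mathbf A^*(Y)$, $\sigma^{d/x}:X\to\mathbf A^*(Y)$ sends $x$ to $d$ and agrees with $\sigma$ elsewhere. Supports. For nonempty $X$ and $t\in\mathbf A(X)$, a subset $U\subseteq X$ is a support for $t$ if $t\sigma=t\tau$ for all $Y$ and all $\sigma,\tau:X\to\mathbf A^*(Y)$ with $\sigma|_U=\tau|_U$; $t$ is closed if $\emptyset$ is a support for $t$ (elements of $\mathbf A(\emptyset)$ are by definition closed). $\mathbf A$ is locally finite if every element of every $\mathbf A(X)$ has a finite support. Standing convention: every quantifier theory considered is nontrivial, meaning that $\mathbf A_*(X)$ has a non-closed element for some nonempty $X\in\mathcal S$. Models. A quantifier model is a quantifier theory $\mathbf B$ over a collection containing $\emptyset$ such that (M1) $\mathbf B^*(\emptyset)\neq\emptyset$ and $\mathbf B_*(\emptyset)$ is a nontrivial Boolean algebra ($0\ne1$); (M2) for nonempty $X$, $x\in X$, $p\in\mathbf B_*(X)$, $\sigma:X\to\mathbf B^*(\emptyset)$, the infimum $\bigwedge_{d\in\mathbf B^*(\emptyset)}p\sigma^{d/x}$ exists in $\mathbf B_*(\emptyset)$ and equals $(\forall x.p)\sigma$. It is a $2$-model if $\mathbf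 B_*(\emptyset)=2=\{0,1\}$. A modification (resp. model, $2$-model) of a quantifier theory $\mathbf A$ over $\mathcal S$ is a quantifier theory (resp. quantifier model, $2$-model) $\mathbf B$ over $\mathcal S\cup\{\emptyset\}$ whose restriction to $\mathcal S\setminus\{\emptyset\}$ equals that of $\mathbf A$. For a filter $I$ of $\mathbf B_*(\emptyset)$, $\mathbf B/I$ is the modification that agrees with $\mathbf B$ except that its Boolean algebra at $\emptyset$ is the quotient $\mathbf B_*(\emptyset)/I$, with $p\sigma$ replaced by its class; $(\mathbf B/I)^*(\emptyset)=\mathbf B^*(\emptyset)$. For an ultrafilter $I$ the quotient is identified with $2=\{0,1\}$. The Boolean operations on $\prod_{i\in\mathcal I}2$ are componentwise. *)

theory Defs
  imports Main "HOL-Library.FuncSet" "HOL-Algebra.Congruence"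
begin

section \<open>Boolean algebras with explicit carrier\<close>

record 'a balg = "'a partial_object" +
  meet :: "'a \<Rightarrow> 'a \<Rightarrow> 'a"
  join :: "'a \<Rightarrow> 'a \<Rightarrow> 'a"
  compl :: "'a \<Rightarrow> 'a"
  bzero :: 'a
  bone :: 'a

text \<open>The axioms are those of the library locale \<open>abstract_boolean_algebra\<close>, relativised to
  the carrier. The one-element Boolean algebra is allowed.\<close>

locale boolean_alg =
  fixes L :: "'a balg"
  assumes meet_closed: "\<lbrakk>p \<in> carrier L; q \<in> carrier L\<rbrakk> \<Longrightarrow> meet L p q \<in> carrier L"
    and join_closed: "\<lbrakk>p \<in> carrier L; q \<in> carrier L\<rbrakk> \<Longrightarrow> join L p q \<in> carrier L"
    and compl_closed: "p \<in> carrier L \<Longrightarrow> compl L p \<in> carrier L"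
    and bzero_closed: "bzero L \<in> carrier L"
    and bone_closed: "bone L \<in> carrier L"
    and meet_assoc: "\<lbrakk>p \<in> carrier L; q \<in> carrier L; r \<in> carrier L\<rbrakk>
      \<Longrightarrow> meet L (meet L p q) r = meet L p (meet L q r)"
    and join_assoc: "\<lbrakk>p \<in> carrier L; q \<in> carrier L; r \<in> carrier L\<rbrakk>
      \<Longrightarrow> join L (join L p q) r = join L p (join L q r)"
    and meet_commute: "\<lbrakk>p \<in> carrier L; q \<in> carrier L\<rbrakk> \<Longrightarrow> meet L p q = meet L q p"
    and join_commute: "\<lbrakk>p \<in> carrier L; q \<in> carrier L\<rbrakk> \<Longrightarrow> join L p q = join L q p"
    and meet_join_distrib: "\<lbrakk>p \<in> carrier L; q \<in> carrier L; r \<in> carrier L\<rbrakk>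
      \<Longrightarrow> meet L p (join L q r) = join L (meet L p q) (meet L p r)"
    and join_meet_distrib: "\<lbrakk>p \<in> carrier L; q \<in> carrier L; r \<in> carrier L\<rbrakk>
      \<Longrightarrow> join L p (meet L q r) = meet L (join L p q) (join L p r)"
    and meet_bone: "p \<in> carrier L \<Longrightarrow> meet L p (bone L) = p"
    and join_bzero: "p \<in> carrier L \<Longrightarrow> join L p (bzero L) = p"
    and meet_compl: "p \<in> carrier L \<Longrightarrow> meet L p (compl L p) = bzero L"
    and join_compl: "p \<in> carrier L \<Longrightarrow> join L p (compl L p) = bone L"

definition balg_le :: "'a balg \<Rightarrow> 'a \<Rightarrow> 'a \<Rightarrow> bool"
  where "balg_le L p q \<longleftrightarrow> meet L p q = p"

definition balg_is_inf :: "'a balg \<Rightarrow> 'a set \<Rightarrow> 'a \<Rightarrow> bool"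
  where "balg_is_inf L D m \<longleftrightarrow>
    m \<in> carrier L \<and> (\<forall>d\<in>D. balg_le L m d) \<and>
    (\<forall>c\<in>carrier L. (\<forall>d\<in>D. balg_le L c d) \<longrightarrow> balg_le L c m)"

definition balg_hom :: "'a balg \<Rightarrow> 'b balg \<Rightarrow> ('a \<Rightarrow> 'b) \<Rightarrow> bool"
  where "balg_hom L M h \<longleftrightarrow>
    h \<in> carrier L \<rightarrow> carrier M \<and>
    (\<forall>p\<in>carrier L. \<forall>q\<in>carrier L. h (meet L p q) = meet M (h p) (h q)) \<and>
    (\<forall>p\<in>carrier L. \<forall>q\<in>carrier L. h (join L p q) = join M (h p) (h q)) \<and>
    (\<forall>p\<in>carrier L. h (compl L p) = compl M (h p)) \<and>
    h (bzero L) = bzero M \<and> h (bone L) = bone M"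

text \<open>Equality of Boolean algebras, disregarding the values of the operations outside the carrier.\<close>

definition balg_eq :: "'a balg \<Rightarrow> 'a balg \<Rightarrow> bool"
  where "balg_eq L M \<longleftrightarrow>
    carrier L = carrier M \<and>
    (\<forall>p\<in>carrier M. \<forall>q\<in>carrier M. meet L p q = meet M p q \<and> join L p q = join M p q) \<and>
    (\<forall>p\<in>carrier M. compl L p = compl M p) \<and>
    bzero L = bzero M \<and> bone L = bone M"

definition balg_filter :: "'a balg \<Rightarrow> 'a set \<Rightarrow> bool"
  where "balg_filter L F \<longleftrightarrow>
    F \<subseteq> carrier L \<and> bone L \<in> F \<and>
    (\<forall>p\<in>F. \<forall>q\<in>F. meet L p q \<in> F) \<and>
    (\<forall>p\<in>F. \<forall>q\<in>carrier L. balg_le L p q \<longrightarrow> q \<in> F)"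

definition balg_ultrafilter :: "'a balg \<Rightarrow> 'a set \<Rightarrow> bool"
  where "balg_ultrafilter L F \<longleftrightarrow>
    balg_filter L F \<and> F \<noteq> carrier L \<and>
    (\<forall>G. balg_filter L G \<and> F \<subseteq> G \<and> G \<noteq> carrier L \<longrightarrow> G = F)"

definition balg_prod :: "'i set \<Rightarrow> ('i \<Rightarrow> 'a balg) \<Rightarrow> ('i \<Rightarrow> 'a) balg"
  where "balg_prod J L =
    \<lparr>carrier = (\<Pi>\<^sub>E i\<in>J. carrier (L i)),
     meet = (\<lambda>p q. \<lambda>i\<in>J. meet (L i) (p i) (q i)),
     join = (\<lambda>p q. \<lambda>i\<in>J. join (L i) (p i) (q i)),
     compl = (\<lambda>p. \<lambda>i\<in>J. compl (L i) (p i)),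
     bzero = (\<lambda>i\<in>J. bzero (L i)),
     bone = (\<lambda>i\<in>J. bone (L i))\<rparr>"

text \<open>Two elements are congruent modulo a filter iff their biimplication lies in the filter.\<close>

definition filter_rel :: "'a balg \<Rightarrow> 'a set \<Rightarrow> ('a \<times> 'a) set"
  where "filter_rel L F = {(p, q). p \<in> carrier L \<and> q \<in> carrier L \<and>
    meet L (join L (compl L p) q) (join L (compl L q) p) \<in> F}"

definition filter_class :: "'a balg \<Rightarrow> 'a set \<Rightarrow> 'a \<Rightarrow> 'a set"
  where "filter_class L F p = filter_rel L F `` {p}"

definition balg_quot :: "'a balg \<Rightarrow> 'a set \<Rightarrow> 'a set balg"
  where "balg_quot L F =
    \<lparr>carrier = carrier L // filter_rel L F,
     meet = (\<lambda>P Q. \<Union>p\<in>P. \<Union>q\<in>Q. filter_class L F (meet L p q)),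
     join = (\<lambda>P Q. \<Union>p\<in>P. \<Union>q\<in>Q. filter_class L F (join L p q)),
     compl = (\<lambda>P. \<Union>p\<in>P. filter_class L F (compl L p)),
     bzero = filter_class L F (bzero L),
     bone = filter_class L F (bone L)\<rparr>"

section \<open>Quantifier theories\<close>

text \<open>
  The data of a theory \<open>A\<close>. In order that the component at the empty set can be exchanged for
  an arbitrary one, it has types of its own: \<open>'t\<close> and \<open>'p\<close> hold the elements of
  \<open>A\<^sup>*(X)\<close> and \<open>A\<^sub>*(X)\<close> for nonempty \<open>X\<close>, while \<open>'d\<close> and \<open>'b\<close> hold the elements of
  \<open>A\<^sup>*({})\<close> and \<open>A\<^sub>*({})\<close>. Fields without suffix \<open>0\<close> are meaningful for nonempty sets of
  variables only; \<open>tsub A X Y a \<sigma>\<close> is \<open>a\<sigma>\<close> for \<open>\<sigma> : X \<rightarrow> A\<^sup>*(Y)\<close> with \<open>Y\<close> nonempty, and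
  \<open>tsub0 A X a \<sigma>\<close> is \<open>a\<sigma>\<close> for \<open>\<sigma> : X \<rightarrow> A\<^sup>*({})\<close>. Fields with suffix \<open>0\<close> are irrelevant if the
  empty set does not belong to the collection. Maps \<open>X \<rightarrow> T\<close> are elements of
  \<open>X \<rightarrow>\<^sub>E T\<close>, so that they are determined by their values on \<open>X\<close>.
\<close>

record ('v, 't, 'p, 'd, 'b) qtheory =
  tms :: "'v set \<Rightarrow> 't set"
  var :: "'v set \<Rightarrow> 'v \<Rightarrow> 't"
  fms :: "'v set \<Rightarrow> 'p balg"
  tsub :: "'v set \<Rightarrow> 'v set \<Rightarrow> 't \<Rightarrow> ('v \<Rightarrow> 't) \<Rightarrow> 't"
  psub :: "'v set \<Rightarrow> 'v set \<Rightarrow> 'p \<Rightarrow> ('v \<Rightarrow> 't) \<Rightarrow> 'p"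
  qall :: "'v set \<Rightarrow> 'v \<Rightarrow> 'p \<Rightarrow> 'p"
  tms0 :: "'d set"
  fms0 :: "'b balg"
  tsub0 :: "'v set \<Rightarrow> 't \<Rightarrow> ('v \<Rightarrow> 'd) \<Rightarrow> 'd"
  psub0 :: "'v set \<Rightarrow> 'p \<Rightarrow> ('v \<Rightarrow> 'd) \<Rightarrow> 'b"

definition var_map :: "('v, 't, 'p, 'd, 'b) qtheory \<Rightarrow> 'v set \<Rightarrow> 'v \<Rightarrow> 't"
  where "var_map A X = (\<lambda>x\<in>X. var A X x)"

text \<open>The composite \<open>\<sigma>\<tau>\<close> for \<open>\<sigma> : X \<rightarrow> A\<^sup>*(Y)\<close> and \<open>\<tau>\<close> from \<open>Y\<close> to \<open>A\<^sup>*(W)\<close>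
  resp. to \<open>A\<^sup>*({})\<close>.\<close>

definition comp_sub :: "('v, 't, 'p, 'd, 'b) qtheory \<Rightarrow> 'v set \<Rightarrow> 'v set \<Rightarrow> 'v set
    \<Rightarrow> ('v \<Rightarrow> 't) \<Rightarrow> ('v \<Rightarrow> 't) \<Rightarrow> 'v \<Rightarrow> 't"
  where "comp_sub A X Y W \<sigma> \<tau> = (\<lambda>x\<in>X. tsub A Y W (\<sigma> x) \<tau>)"

definition comp_sub0 :: "('v, 't, 'p, 'd, 'b) qtheory \<Rightarrow> 'v set \<Rightarrow> 'v set
    \<Rightarrow> ('v \<Rightarrow> 't) \<Rightarrow> ('v \<Rightarrow> 'd) \<Rightarrow> 'v \<Rightarrow> 'd"
  where "comp_sub0 A X Y \<sigma> \<tau> = (\<lambda>x\<in>X. tsub0 A Y (\<sigma> x) \<tau>)"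

text \<open>\<open>single_sub A Y d y\<close> is the substitution \<open>[d/y]\<close> on \<open>Y\<close>. The map \<open>\<sigma>\<^sup>d\<^sup>/\<^sup>x\<close> of
  \<open>\<sigma>\<close> is written \<open>\<sigma>(x := d)\<close>.\<close>

definition single_sub :: "('v, 't, 'p, 'd, 'b) qtheory \<Rightarrow> 'v set \<Rightarrow> 't \<Rightarrow> 'v \<Rightarrow> 'v \<Rightarrow> 't"
  where "single_sub A Y d y = (var_map A Y)(y := d)"

definition term_support ::
    "'v set set \<Rightarrow> ('v, 't, 'p, 'd, 'b) qtheory \<Rightarrow> 'v set \<Rightarrow> 't \<Rightarrow> 'v set \<Rightarrow> bool"
  where "term_support S A X a U \<longleftrightarrow> U \<subseteq> X \<and>
    (\<forall>Y\<in>S. Y \<noteq> {} \<longrightarrow> (\<forall>\<sigma>\<in>X \<rightarrow>\<^sub>E tms A Y. \<forall>\<tau>\<in>X \<rightarrow>\<^sub>E tms A Y.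
       (\<forall>x\<in>U. \<sigma> x = \<tau> x) \<longrightarrow> tsub A X Y a \<sigma> = tsub A X Y a \<tau>)) \<and>
    ({} \<in> S \<longrightarrow> (\<forall>\<sigma>\<in>X \<rightarrow>\<^sub>E tms0 A. \<forall>\<tau>\<in>X \<rightarrow>\<^sub>E tms0 A.
       (\<forall>x\<in>U. \<sigma> x = \<tau> x) \<longrightarrow> tsub0 A X a \<sigma> = tsub0 A X a \<tau>))"

definition formula_support ::
    "'v set set \<Rightarrow> ('v, 't, 'p, 'd, 'b) qtheory \<Rightarrow> 'v set \<Rightarrow> 'p \<Rightarrow> 'v set \<Rightarrow> bool"
  where "formula_support S A X p U \<longleftrightarrow> U \<subseteq> X \<and>
    (\<forall>Y\<in>S. Y \<noteq> {} \<longrightarrow> (\<forall>\<sigma>\<in>X \<rightarrow>\<^sub>E tms A Y. \<forall>\<tau>\<in>X \<rightarrow>\<^sub>E tms A Y.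
       (\<forall>x\<in>U. \<sigma> x = \<tau> x) \<longrightarrow> psub A X Y p \<sigma> = psub A X Y p \<tau>)) \<and>
    ({} \<in> S \<longrightarrow> (\<forall>\<sigma>\<in>X \<rightarrow>\<^sub>E tms0 A. \<forall>\<tau>\<in>X \<rightarrow>\<^sub>E tms0 A.
       (\<forall>x\<in>U. \<sigma> x = \<tau> x) \<longrightarrow> psub0 A X p \<sigma> = psub0 A X p \<tau>))"

text \<open>Elements over the empty set are closed by definition, so only nonempty \<open>X\<close> matter.\<close>

definition locally_finite :: "'v set set \<Rightarrow> ('v, 't, 'p, 'd, 'b) qtheory \<Rightarrow> bool"
  where "locally_finite S A \<longleftrightarrow> (\<forall>X\<in>S. X \<noteq> {} \<longrightarrow>
    (\<forall>a\<in>tms A X. \<exists>U. finite U \<and> term_support S A X a U) \<and>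
    (\<forall>p\<in>carrier (fms A X). \<exists>U. finite U \<and> formula_support S A X p U))"

text \<open>Where the target \<open>Y\<close> (in P2: \<open>W\<close>) may be empty, the axiom appears a second time, with
  suffix \<open>0\<close>, for the empty target. The last assumption is the convention that theories are
  nontrivial: some element is not closed.\<close>

locale quantifier_theory =
  fixes S :: "'v set set" and A :: "('v, 't, 'p, 'd, 'b) qtheory"
  assumes infinite_member: "\<exists>X\<in>S. infinite X"
    and var_closed: "\<lbrakk>X \<in> S; x \<in> X\<rbrakk> \<Longrightarrow> var A X x \<in> tms A X"
    and fms_boolean: "\<lbrakk>X \<in> S; X \<noteq> {}\<rbrakk> \<Longrightarrow> boolean_alg (fms A X)"
    and fms_boolean0: "{} \<in> S \<Longrightarrow> boolean_alg (fms0 A)"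
    and tsub_closed: "\<lbrakk>X \<in> S; X \<noteq> {}; Y \<in> S; Y \<noteq> {}; a \<in> tms A X; \<sigma> \<in> X \<rightarrow>\<^sub>E tms A Y\<rbrakk>
      \<Longrightarrow> tsub A X Y a \<sigma> \<in> tms A Y"
    and tsub_closed0: "\<lbrakk>X \<in> S; X \<noteq> {}; {} \<in> S; a \<in> tms A X; \<rho> \<in> X \<rightarrow>\<^sub>E tms0 A\<rbrakk>
      \<Longrightarrow> tsub0 A X a \<rho> \<in> tms0 A"
    and psub_closed: "\<lbrakk>X \<in> S; X \<noteq> {}; Y \<in> S; Y \<noteq> {}; p \<in> carrier (fms A X);
        \<sigma> \<in> X \<rightarrow>\<^sub>E tms A Y\<rbrakk> \<Longrightarrow> psub A X Y p \<sigma> \<in> carrier (fms A Y)"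
    and psub_closed0: "\<lbrakk>X \<in> S; X \<noteq> {}; {} \<in> S; p \<in> carrier (fms A X); \<rho> \<in> X \<rightarrow>\<^sub>E tms0 A\<rbrakk>
      \<Longrightarrow> psub0 A X p \<rho> \<in> carrier (fms0 A)"
    and qall_closed: "\<lbrakk>X \<in> S; x \<in> X; p \<in> carrier (fms A X)\<rbrakk>
      \<Longrightarrow> qall A X x p \<in> carrier (fms A X)"
    and P1_tm: "\<lbrakk>X \<in> S; X \<noteq> {}; a \<in> tms A X\<rbrakk> \<Longrightarrow> tsub A X X a (var_map A X) = a"
    and P1_fm: "\<lbrakk>X \<in> S; X \<noteq> {}; p \<in> carrier (fms A X)\<rbrakk>
      \<Longrightarrow> psub A X X p (var_map A X) = p"
    and P2_tm: "\<lbrakk>X \<in> S; X \<noteq> {}; Y \<in> S; Y \<noteq> {}; W \<in> S; W \<noteq> {}; a \<in> tms A X;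
        \<sigma> \<in> X \<rightarrow>\<^sub>E tms A Y; \<tau> \<in> Y \<rightarrow>\<^sub>E tms A W\<rbrakk>
      \<Longrightarrow> tsub A Y W (tsub A X Y a \<sigma>) \<tau> = tsub A X W a (comp_sub A X Y W \<sigma> \<tau>)"
    and P2_fm: "\<lbrakk>X \<in> S; X \<noteq> {}; Y \<in> S; Y \<noteq> {}; W \<in> S; W \<noteq> {}; p \<in> carrier (fms A X);
        \<sigma> \<in> X \<rightarrow>\<^sub>E tms A Y; \<tau> \<in> Y \<rightarrow>\<^sub>E tms A W\<rbrakk>
      \<Longrightarrow> psub A Y W (psub A X Y p \<sigma>) \<tau> = psub A X W p (comp_sub A X Y W \<sigma> \<tau>)"
    and P2_tm0: "\<lbrakk>X \<in> S; X \<noteq> {}; Y \<in> S; Y \<noteq> {}; {} \<in> S; a \<in> tms A X;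
        \<sigma> \<in> X \<rightarrow>\<^sub>E tms A Y; \<rho> \<in> Y \<rightarrow>\<^sub>E tms0 A\<rbrakk>
      \<Longrightarrow> tsub0 A Y (tsub A X Y a \<sigma>) \<rho> = tsub0 A X a (comp_sub0 A X Y \<sigma> \<rho>)"
    and P2_fm0: "\<lbrakk>X \<in> S; X \<noteq> {}; Y \<in> S; Y \<noteq> {}; {} \<in> S; p \<in> carrier (fms A X);
        \<sigma> \<in> X \<rightarrow>\<^sub>E tms A Y; \<rho> \<in> Y \<rightarrow>\<^sub>E tms0 A\<rbrakk>
      \<Longrightarrow> psub0 A Y (psub A X Y p \<sigma>) \<rho> = psub0 A X p (comp_sub0 A X Y \<sigma> \<rho>)"
    and P3: "\<lbrakk>X \<in> S; Y \<in> S; Y \<noteq> {}; x \<in> X; \<sigma> \<in> X \<rightarrow>\<^sub>E tms A Y\<rbrakk>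
      \<Longrightarrow> tsub A X Y (var A X x) \<sigma> = \<sigma> x"
    and P3_0: "\<lbrakk>X \<in> S; {} \<in> S; x \<in> X; \<rho> \<in> X \<rightarrow>\<^sub>E tms0 A\<rbrakk>
      \<Longrightarrow> tsub0 A X (var A X x) \<rho> = \<rho> x"
    and P4: "\<lbrakk>X \<in> S; X \<noteq> {}; Y \<in> S; Y \<noteq> {}; \<sigma> \<in> X \<rightarrow>\<^sub>E tms A Y\<rbrakk>
      \<Longrightarrow> balg_hom (fms A X) (fms A Y) (\<lambda>p. psub A X Y p \<sigma>)"
    and P4_0: "\<lbrakk>X \<in> S; X \<noteq> {}; {} \<in> S; \<rho> \<in> X \<rightarrow>\<^sub>E tms0 A\<rbrakk>
      \<Longrightarrow> balg_hom (fms A X) (fms0 A) (\<lambda>p. psub0 A X p \<rho>)"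
    and P5: "\<lbrakk>X \<in> S; Y \<in> S; x \<in> X; p \<in> carrier (fms A X); \<sigma> \<in> X \<rightarrow>\<^sub>E tms A Y;
        y \<in> Y; z \<in> Y; y \<noteq> z; comp_sub A X Y Y \<sigma> (single_sub A Y (var A Y z) y) = \<sigma>\<rbrakk>
      \<Longrightarrow> psub A X Y (qall A X x p) \<sigma> = qall A Y y (psub A X Y p (\<sigma>(x := var A Y y)))"
    and Q1: "\<lbrakk>X \<in> S; x \<in> X; p \<in> carrier (fms A X); q \<in> carrier (fms A X)\<rbrakk>
      \<Longrightarrow> qall A X x (meet (fms A X) p q) = meet (fms A X) (qall A X x p) (qall A X x q)"
    and Q2: "\<lbrakk>X \<in> S; x \<in> X; p \<in> carrier (fms A X)\<rbrakk>
      \<Longrightarrow> balg_le (fms A X) (qall A X x p) p"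
    and Q3: "\<lbrakk>X \<in> S; x \<in> X; p \<in> carrier (fms A X); y \<in> X; y \<noteq> x;
        psub A X X p (single_sub A X (var A X y) x) = p\<rbrakk>
      \<Longrightarrow> qall A X x p = p"
    and nontrivial: "\<exists>X\<in>S. X \<noteq> {} \<and> (\<exists>p\<in>carrier (fms A X). \<not> formula_support S A X p {})"

section \<open>Models and modifications\<close>

locale quantifier_model = quantifier_theory S B
  for S :: "'v set set" and B :: "('v, 't, 'p, 'd, 'b) qtheory" +
  assumes empty_member: "{} \<in> S"
    and M1_tm: "tms0 B \<noteq> {}"
    and M1_fm: "bzero (fms0 B) \<noteq> bone (fms0 B)"
    and M2: "\<lbrakk>X \<in> S; x \<in> X; p \<in> carrier (fms B X); \<sigma> \<in> X \<rightarrow>\<^sub>E tms0 B\<rbrakk>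
      \<Longrightarrow> balg_is_inf (fms0 B) ((\<lambda>d. psub0 B X p (\<sigma>(x := d))) ` tms0 B)
            (psub0 B X (qall B X x p) \<sigma>)"

locale two_model = quantifier_model S B
  for S :: "'v set set" and B :: "('v, 't, 'p, 'd, 'b) qtheory" +
  assumes fms0_two: "carrier (fms0 B) = {bzero (fms0 B), bone (fms0 B)}"

text \<open>\<open>B\<close> and \<open>A\<close> have the same restriction to \<open>S - {{}}\<close>; their components at the empty set
  may be of different types.\<close>

definition same_restriction ::
    "'v set set \<Rightarrow> ('v, 't, 'p, 'd, 'b) qtheory \<Rightarrow> ('v, 't, 'p, 'e, 'c) qtheory \<Rightarrow> bool"
  where "same_restriction S A B \<longleftrightarrow> (\<forall>X\<in>S - {{}}.
    tms B X = tms A X \<and>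
    (\<forall>x\<in>X. var B X x = var A X x) \<and>
    balg_eq (fms B X) (fms A X) \<and>
    (\<forall>Y\<in>S - {{}}. \<forall>\<sigma>\<in>X \<rightarrow>\<^sub>E tms A Y.
       (\<forall>a\<in>tms A X. tsub B X Y a \<sigma> = tsub A X Y a \<sigma>) \<and>
       (\<forall>p\<in>carrier (fms A X). psub B X Y p \<sigma> = psub A X Y p \<sigma>)) \<and>
    (\<forall>x\<in>X. \<forall>p\<in>carrier (fms A X). qall B X x p = qall A X x p))"

definition model_of ::
    "'v set set \<Rightarrow> ('v, 't, 'p, 'd, 'b) qtheory \<Rightarrow> ('v, 't, 'p, 'e, 'c) qtheory \<Rightarrow> bool"
  where "model_of S A B \<longleftrightarrow> quantifier_model (S \<union> {{}}) B \<and> same_restriction S A B"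

definition two_model_of ::
    "'v set set \<Rightarrow> ('v, 't, 'p, 'd, 'b) qtheory \<Rightarrow> ('v, 't, 'p, 'e, 'c) qtheory \<Rightarrow> bool"
  where "two_model_of S A B \<longleftrightarrow> two_model (S \<union> {{}}) B \<and> same_restriction S A B"

text \<open>The modification of \<open>A\<close> whose component at the empty set is the product of those of the
  \<open>Bs i\<close>. If these are 2-models, then each \<open>fms0 (Bs i)\<close> is the Boolean algebra 2 with
  elements \<open>bzero (fms0 (Bs i))\<close> and \<open>bone (fms0 (Bs i))\<close>.\<close>

definition prod_modification ::
    "('v, 't, 'p, 'd, 'b) qtheory \<Rightarrow> 'i set \<Rightarrow> ('i \<Rightarrow> ('v, 't, 'p, 'e, 'c) qtheory)
      \<Rightarrow> ('v, 't, 'p, 'i \<Rightarrow> 'e, 'i \<Rightarrow> 'c) qtheory"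
  where "prod_modification A J Bs =
    \<lparr>tms = tms A, var = var A, fms = fms A, tsub = tsub A, psub = psub A, qall = qall A,
     tms0 = (\<Pi>\<^sub>E i\<in>J. tms0 (Bs i)),
     fms0 = balg_prod J (\<lambda>i. fms0 (Bs i)),
     tsub0 = (\<lambda>X a \<sigma>. \<lambda>i\<in>J. tsub0 (Bs i) X a (\<lambda>x\<in>X. \<sigma> x i)),
     psub0 = (\<lambda>X p \<sigma>. \<lambda>i\<in>J. psub0 (Bs i) X p (\<lambda>x\<in>X. \<sigma> x i))\<rparr>"

definition quot_modification ::
    "('v, 't, 'p, 'd, 'b) qtheory \<Rightarrow> 'b set \<Rightarrow> ('v, 't, 'p, 'd, 'b set) qtheory"
  where "quot_modification B F =
    \<lparr>tms = tms B, var = var B, fms = fms B, tsub = tsub B, psub = psub B, qall = qall B,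
     tms0 = tms0 B,
     fms0 = balg_quot (fms0 B) F,
     tsub0 = tsub0 B,
     psub0 = (\<lambda>X p \<sigma>. filter_class (fms0 B) F (psub0 B X p \<sigma>))\<rparr>"

end

theory Submission
  imports Defs
begin

text \<open>
  In a 2-model every infimum \<open>\<And>\<^sub>d p\<sigma>\<^sup>d\<^sup>/\<^sup>x\<close> is attained, since the Boolean algebra has only two
  elements. Choosing minimisers componentwise, the infima in the product are attained as well,
  and an attained infimum is preserved by every homomorphism, in particular by the quotient map
  of an ultrafilter. The axioms of a quantifier theory at the empty set hold componentwise in the
  product and are inherited by the quotient.
\<close>

section \<open>Boolean algebras and ultrafilters\<close>

text \<open>Part (b) is an algebraic form of the ultraproduct theorem of Los, with the quantifier as
  its delicate case. A quotient map respects finite meets but in general not infinite ones, so M2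
  for the product does not by itself yield M2 for the quotient. For this reason the existence of a
  witness for every quantifier, the predicate \<open>witnessing\<close>, is kept as a property in
  its own right beside that of being a model. Elements of the domain are never identified: the
  quotient keeps \<open>tms0\<close> and \<open>tsub0\<close> and collapses truth values only, so
  the laws for terms at the empty set carry over verbatim.\<close>

context boolean_alg
begin

text \<open>p = p \<and> (p \<or> \<not>p) = (p \<and> p) \<or> 0.\<close>

lemma meet_idem: "p \<in> carrier L \<Longrightarrow> meet L p p = p"
  by (metis bone_closed compl_closed join_bzero join_compl meet_bone meet_closed meet_compl
      meet_join_distrib)

lemma meet_bzero: "p \<in> carrier L \<Longrightarrow> meet L p (bzero L) = bzero L"
  by (metis compl_closed meet_assoc meet_compl meet_idem)

text \<open>With p written as p \<or> 0, distributivity turns the meet into p \<or> (0 \<and> q),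
  which is p.\<close>

lemma meet_join_absorb:
  "\<lbrakk>p \<in> carrier L; q \<in> carrier L\<rbrakk> \<Longrightarrow> meet L p (join L p q) = p"
  by (metis bzero_closed join_bzero join_meet_distrib meet_bzero meet_commute)

lemma le_join1: "\<lbrakk>p \<in> carrier L; q \<in> carrier L\<rbrakk> \<Longrightarrow> balg_le L p (join L p q)"
  by (simp add: balg_le_def meet_join_absorb)

lemma le_join2: "\<lbrakk>p \<in> carrier L; q \<in> carrier L\<rbrakk> \<Longrightarrow> balg_le L q (join L p q)"
  by (metis join_commute le_join1)

lemma meet_le1: "\<lbrakk>p \<in> carrier L; q \<in> carrier L\<rbrakk> \<Longrightarrow> balg_le L (meet L p q) p"
  unfolding balg_le_def by (metis meet_assoc meet_closed meet_commute meet_idem)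

lemma meet_le2: "\<lbrakk>p \<in> carrier L; q \<in> carrier L\<rbrakk> \<Longrightarrow> balg_le L (meet L p q) q"
  unfolding balg_le_def by (metis meet_assoc meet_idem)

lemma le_trans:
  "\<lbrakk>balg_le L p q; balg_le L q r; p \<in> carrier L; q \<in> carrier L; r \<in> carrier L\<rbrakk>
    \<Longrightarrow> balg_le L p r"
  unfolding balg_le_def by (metis meet_assoc)

lemma meet_left_commute:
  "\<lbrakk>p \<in> carrier L; q \<in> carrier L; r \<in> carrier L\<rbrakk> \<Longrightarrow> meet L p (meet L q r) = meet L q (meet L p r)"
  by (metis meet_assoc meet_commute)

lemmas meet_ac = meet_assoc meet_commute meet_left_commute

lemma meet_mono:
  "\<lbrakk>balg_le L p q; balg_le L p' q'; p \<in> carrier L; q \<in> carrier L; p' \<in> carrier L; q' \<in> carrier L\<rbrakk>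
    \<Longrightarrow> balg_le L (meet L p p') (meet L q q')"
proof -
  assume C: "p \<in> carrier L" "q \<in> carrier L" "p' \<in> carrier L" "q' \<in> carrier L"
  assume "balg_le L p q" "balg_le L p' q'"
  moreover have "meet L (meet L p p') (meet L q q') = meet L (meet L p q) (meet L p' q')"
    using C by (simp add: meet_ac meet_closed)
  ultimately show ?thesis by (simp add: balg_le_def)
qed

lemma bzero_le: "p \<in> carrier L \<Longrightarrow> balg_le L (bzero L) p"
  unfolding balg_le_def by (metis bzero_closed meet_bzero meet_commute)

text \<open>If m is 1, every element of the nonempty set D lies above 1 and hence equals m. If m is
  0 and D misses it, D consists of 1 alone, so 1 is a lower bound and 1 \<le> m, which makes m equal
  to 1 after all. Since the contradiction is with m \<noteq> 1, an algebra with 0 = 1 needs no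
  separate case.\<close>

lemma two_element_inf_attained:
  assumes two: "carrier L = {bzero L, bone L}" and D: "D \<subseteq> carrier L" "D \<noteq> {}"
    and m: "balg_is_inf L D m"
  shows "m \<in> D"
proof (rule ccontr)
  assume "m \<notin> D"
  have mC: "m \<in> carrier L" and low: "\<And>d. d \<in> D \<Longrightarrow> balg_le L m d"
    using m by (auto simp: balg_is_inf_def)
  have "\<not> m = bone L"
  proof
    assume "m = bone L"
    moreover obtain d where d: "d \<in> D" using D by blast
    ultimately have "d = m"
      using low[OF d] D mC unfolding balg_le_def
      by (metis meet_bone meet_commute subsetD)
    with d \<open>m \<notin> D\<close> show False by simp
  qed
  then have m0: "m = bzero L" using two mC by simp
  then have "\<And>d. d \<in> D \<Longrightarrow> d = bone L" using D \<open>m \<notin> D\<close> two by auto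
  then have "\<forall>d\<in>D. balg_le L (bone L) d"
    by (metis balg_le_def bone_closed meet_bone)
  then have "balg_le L (bone L) m"
    using m bone_closed by (simp add: balg_is_inf_def)
  then show False
    using m0 \<open>m \<noteq> bone L\<close> by (simp add: balg_le_def meet_bzero bone_closed)
qed

end

section \<open>Homomorphisms and attained infima\<close>

lemma balg_hom_le:
  "\<lbrakk>balg_hom L M h; balg_le L p q; p \<in> carrier L; q \<in> carrier L\<rbrakk> \<Longrightarrow> balg_le M (h p) (h q)"
  unfolding balg_hom_def balg_le_def by metis

lemma attained_inf:
  "\<lbrakk>m \<in> D; m \<in> carrier L; \<And>d. d \<in> D \<Longrightarrow> balg_le L m d\<rbrakk> \<Longrightarrow> balg_is_inf L D m"
  by (simp add: balg_is_inf_def)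

text \<open>Homomorphisms are monotone, so the least element of D is sent to the least element of
  the image. An infimum outside D would offer no such argument: nothing bounds the lower bounds of
  the image that do not come from L.\<close>

lemma balg_is_inf_hom_image:
  assumes "balg_is_inf L D m" "m \<in> D" "D \<subseteq> carrier L" "balg_hom L M h"
  shows "balg_is_inf M (h ` D) (h m)"
proof (rule attained_inf)
  have m: "m \<in> carrier L" and low: "\<And>d. d \<in> D \<Longrightarrow> balg_le L m d"
    using assms(1) by (auto simp: balg_is_inf_def)
  show "h m \<in> h ` D" using assms(2) by (rule imageI)
  show "h m \<in> carrier M" using assms(4) m by (auto simp: balg_hom_def)
  fix e assume "e \<in> h ` D"
  then obtain d where "d \<in> D" "e = h d" by blast
  then show "balg_le M (h m) e"
    using balg_hom_le[OF assms(4) low m] assms(3) by blast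
qed

lemma balg_hom_comp:
  "\<lbrakk>balg_hom K L g; balg_hom L M h\<rbrakk> \<Longrightarrow> balg_hom K M (\<lambda>p. h (g p))"
  unfolding balg_hom_def by (simp add: Pi_iff)

section \<open>Quotients of Boolean algebras by ultrafilters\<close>

locale boolean_ultrafilter = boolean_alg +
  fixes F
  assumes ultra: "balg_ultrafilter L F"
begin

lemma sub: "p \<in> F \<Longrightarrow> p \<in> carrier L"
  using ultra by (auto simp: balg_ultrafilter_def balg_filter_def)

lemma bone_mem: "bone L \<in> F"
  using ultra by (auto simp: balg_ultrafilter_def balg_filter_def)

lemma upward: "\<lbrakk>p \<in> F; q \<in> carrier L; balg_le L p q\<rbrakk> \<Longrightarrow> q \<in> F"
  using ultra by (auto simp: balg_ultrafilter_def balg_filter_def)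

lemma bzero_not_mem: "bzero L \<notin> F"
proof
  assume "bzero L \<in> F"
  then have "F = carrier L" using bzero_le upward sub by blast
  then show False using ultra by (simp add: balg_ultrafilter_def)
qed

lemma meet_mem_iff:
  assumes "p \<in> carrier L" "q \<in> carrier L"
  shows "meet L p q \<in> F \<longleftrightarrow> p \<in> F \<and> q \<in> F"
proof
  assume "meet L p q \<in> F"
  then show "p \<in> F \<and> q \<in> F" using assms upward meet_le1 meet_le2 by blast
next
  assume "p \<in> F \<and> q \<in> F"
  then show "meet L p q \<in> F"
    using ultra by (auto simp: balg_ultrafilter_def balg_filter_def)
qed

text \<open>Maximality enters here. If p is outside F, the filter generated by F and p is improper,
  so f \<and> p = 0 for some f in F, and then f \<le> \<not>p.\<close>

lemma compl_mem_iff: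
  assumes p: "p \<in> carrier L"
  shows "compl L p \<in> F \<longleftrightarrow> p \<notin> F"
proof
  assume "compl L p \<in> F"
  then show "p \<notin> F"
    using meet_mem_iff[OF p compl_closed[OF p]] meet_compl[OF p] bzero_not_mem by auto
next
  assume pF: "p \<notin> F"
  \<comment> \<open>The filter generated by F together with p.\<close>
  define G where "G = {q \<in> carrier L. \<exists>f\<in>F. balg_le L (meet L f p) q}"
  have "balg_filter L G"
    unfolding balg_filter_def
  proof (intro conjI ballI impI)
    show "G \<subseteq> carrier L" by (auto simp: G_def)
    show "bone L \<in> G"
      using bone_mem sub p meet_bone by (auto simp: G_def balg_le_def meet_closed bone_closed)
  next
    fix q r assume "q \<in> G" "r \<in> G"
    then obtain f g where q: "q \<in> carrier L" "f \<in> F" "balg_le L (meet L f p) q"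
      and r: "r \<in> carrier L" "g \<in> F" "balg_le L (meet L g p) r" by (auto simp: G_def)
    have C: "f \<in> carrier L" "g \<in> carrier L" using q r sub by auto
    have "meet L (meet L f p) (meet L g p) = meet L (meet L f g) p"
      using C p by (metis meet_ac(1,2) meet_closed meet_idem)
    then have "balg_le L (meet L (meet L f g) p) (meet L q r)"
      using meet_mono[OF q(3) r(3)] q r C p meet_closed by auto
    then show "meet L q r \<in> G"
      using q r C meet_mem_iff[of f g] by (auto simp: G_def meet_closed)
  next
    fix q r assume "q \<in> G" "r \<in> carrier L" "balg_le L q r"
    then show "r \<in> G"
      using p sub le_trans meet_closed unfolding G_def by blast
  qed
  moreover have "F \<subseteq> G"
    using sub p meet_le1 by (auto simp: G_def)
  moreover have "p \<in> G"
    using bone_mem p bone_closed meet_le2 by (auto simp: G_def)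
  ultimately have "G = carrier L"
    using ultra pF unfolding balg_ultrafilter_def by blast
  then obtain f where f: "f \<in> F" "balg_le L (meet L f p) (bzero L)"
    using bzero_closed by (auto simp: G_def)
  then have fC: "f \<in> carrier L" using sub by simp
  have "meet L f p = bzero L"
    using f fC p by (simp add: balg_le_def meet_bzero meet_closed)
  \<comment> \<open>Expand f as f \<and> (p \<or> \<not>p) and drop the first summand, which is
    0.\<close>
  then have "meet L f (compl L p) = f"
    using meet_join_distrib[OF fC p compl_closed[OF p]] fC p
    by (simp add: join_compl meet_bone join_commute[of "bzero L"] join_bzero bzero_closed
        meet_closed compl_closed)
  then show "compl L p \<in> F"
    using f fC p upward compl_closed by (auto simp: balg_le_def)
qed

text \<open>Primeness of F. In place of a De Morgan law it suffices that \<not>p \<and> \<not>q is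
  disjoint from p and from q, hence from their join; two members of F cannot be disjoint.\<close>

lemma join_mem_iff:
  assumes p: "p \<in> carrier L" and q: "q \<in> carrier L"
  shows "join L p q \<in> F \<longleftrightarrow> p \<in> F \<or> q \<in> F"
proof
  assume j: "join L p q \<in> F"
  show "p \<in> F \<or> q \<in> F"
  proof (rule ccontr)
    assume "\<not> (p \<in> F \<or> q \<in> F)"
    define c where "c = meet L (compl L p) (compl L q)"
    have cC: "c \<in> carrier L" using p q by (simp add: c_def compl_closed meet_closed)
    have cF: "c \<in> F"
      using \<open>\<not> (p \<in> F \<or> q \<in> F)\<close> p q by (simp add: c_def meet_mem_iff compl_mem_iff compl_closed)
    have "meet L c p = meet L (compl L q) (meet L p (compl L p))"
      "meet L c q = meet L (compl L p) (meet L q (compl L q))"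
      unfolding c_def using p q by (simp_all add: meet_ac meet_closed compl_closed)
    then have "meet L c p = bzero L" "meet L c q = bzero L"
      using p q by (simp_all add: meet_compl meet_bzero compl_closed)
    then have "meet L c (join L p q) = bzero L"
      using p q cC by (simp add: meet_join_distrib join_bzero bzero_closed)
    then show False
      using j cF meet_mem_iff[OF cC join_closed[OF p q]] bzero_not_mem by simp
  qed
next
  assume "p \<in> F \<or> q \<in> F"
  then show "join L p q \<in> F"
    using upward[OF _ join_closed[OF p q]] le_join1[OF p q] le_join2[OF p q] by blast
qed

text \<open>The two congruence classes modulo F, indexed by truth values: \<open>side True\<close>
  is F and \<open>side False\<close> its complement in the carrier. Under this indexing the
  operations of the quotient become the connectives of \<open>bool\<close>.\<close>

definition side :: "bool \<Rightarrow> 'a set" where "side b = {p \<in> carrier L. p \<in> F \<longleftrightarrow> b}"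

text \<open>By the three membership rules, the biimplication of p and q lies in F exactly when p and
  q lie on the same side of F.\<close>

lemma filter_class_eq_side: "p \<in> carrier L \<Longrightarrow> filter_class L F p = side (p \<in> F)"
  by (auto simp: filter_class_def filter_rel_def side_def meet_mem_iff join_mem_iff
      compl_mem_iff join_closed compl_closed)

lemma side_nonempty: "side b \<noteq> {}"
proof (cases b)
  case True
  then show ?thesis using bone_mem bone_closed by (auto simp: side_def)
next
  case False
  then show ?thesis using bzero_not_mem bzero_closed by (auto simp: side_def)
qed

lemma side_inject: "side b = side c \<longleftrightarrow> b = c"
  using side_nonempty by (auto simp: side_def)

text \<open>An operation of the quotient is a union over all representatives. The side of the result
  depends only on the sides of the arguments, so the union is constant over a nonempty index set;
  this is well-definedness.\<close>

lemma quot_simps: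
  "carrier (balg_quot L F) = range side"
  "meet (balg_quot L F) (side b) (side c) = side (b \<and> c)"
  "join (balg_quot L F) (side b) (side c) = side (b \<or> c)"
  "compl (balg_quot L F) (side b) = side (\<not> b)"
  "bzero (balg_quot L F) = side False"
  "bone (balg_quot L F) = side True"
proof -
  have "carrier (balg_quot L F) = filter_class L F ` carrier L"
    by (auto simp: balg_quot_def quotient_def filter_class_def)
  also have "\<dots> = (\<lambda>p. side (p \<in> F)) ` carrier L"
    by (simp add: filter_class_eq_side)
  also have "\<dots> = range side"
  proof -
    have "b \<in> (\<lambda>p. p \<in> F) ` carrier L" for b
      using side_nonempty[of b] by (auto simp: side_def)
    then have "(\<lambda>p. p \<in> F) ` carrier L = UNIV" by blast
    then show ?thesis by (metis image_image)
  qed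
  finally show "carrier (balg_quot L F) = range side" .
  have mem: "p \<in> side b \<longleftrightarrow> p \<in> carrier L \<and> (p \<in> F \<longleftrightarrow> b)" for p b
    by (simp add: side_def)
  show "meet (balg_quot L F) (side b) (side c) = side (b \<and> c)"
  proof -
    have "meet (balg_quot L F) (side b) (side c) = (\<Union>p\<in>side b. \<Union>q\<in>side c. side (b \<and> c))"
      unfolding balg_quot_def balg.simps
      by (intro SUP_cong refl) (simp add: mem filter_class_eq_side meet_closed meet_mem_iff)
    then show ?thesis using side_nonempty by simp
  qed
  show "join (balg_quot L F) (side b) (side c) = side (b \<or> c)"
  proof -
    have "join (balg_quot L F) (side b) (side c) = (\<Union>p\<in>side b. \<Union>q\<in>side c. side (b \<or> c))"
      unfolding balg_quot_def balg.simps
      by (intro SUP_cong refl) (simp add: mem filter_class_eq_side join_closed join_mem_iff)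
    then show ?thesis using side_nonempty by simp
  qed
  show "compl (balg_quot L F) (side b) = side (\<not> b)"
  proof -
    have "compl (balg_quot L F) (side b) = (\<Union>p\<in>side b. side (\<not> b))"
      unfolding balg_quot_def balg.simps
      by (intro SUP_cong refl) (simp add: mem filter_class_eq_side compl_closed compl_mem_iff)
    then show ?thesis using side_nonempty by simp
  qed
  show "bzero (balg_quot L F) = side False" "bone (balg_quot L F) = side True"
    by (simp_all add: balg_quot_def filter_class_eq_side bzero_closed bone_closed
        bzero_not_mem bone_mem)
qed

text \<open>Every element is a \<open>side b\<close>, so each axiom becomes a propositional
  tautology.\<close>

lemma boolean_alg_quot: "boolean_alg (balg_quot L F)"
  by (unfold_locales; clarsimp simp: quot_simps; auto intro!: arg_cong[of _ _ side])

lemma balg_hom_quot: "balg_hom L (balg_quot L F) (filter_class L F)"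
  by (auto simp: balg_hom_def quot_simps filter_class_eq_side meet_closed join_closed compl_closed
      bzero_closed bone_closed meet_mem_iff join_mem_iff compl_mem_iff bzero_not_mem bone_mem)

lemma quot_two: "carrier (balg_quot L F) = {bzero (balg_quot L F), bone (balg_quot L F)}"
  using UNIV_bool by (auto simp: quot_simps)

lemma quot_nontrivial: "bzero (balg_quot L F) \<noteq> bone (balg_quot L F)"
  by (simp add: quot_simps side_inject)

end

section \<open>Products of Boolean algebras\<close>

lemma boolean_alg_prod:
  assumes "\<And>i. i \<in> J \<Longrightarrow> boolean_alg (L i)"
  shows "boolean_alg (balg_prod J L)"
proof
  note ax = boolean_alg.meet_closed boolean_alg.join_closed boolean_alg.compl_closed
    boolean_alg.bzero_closed boolean_alg.bone_closed boolean_alg.meet_assoc boolean_alg.join_assoc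
    boolean_alg.meet_bone
    boolean_alg.join_bzero boolean_alg.meet_compl boolean_alg.join_compl
  fix p q r
  assume p: "p \<in> carrier (balg_prod J L)"
  \<comment> \<open>The unit laws have a bare p on the right, whereas the operations return
    functions restricted to J; extensionality of p closes this gap.\<close>
  then have pe: "(\<lambda>i\<in>J. p i) = p" by (simp add: balg_prod_def PiE_restrict)
  have pi: "\<And>i. i \<in> J \<Longrightarrow> p i \<in> carrier (L i)" using p by (auto simp: balg_prod_def)
  show "compl (balg_prod J L) p \<in> carrier (balg_prod J L)"
    using pi assms by (auto simp: balg_prod_def ax)
  have "meet (balg_prod J L) p (bone (balg_prod J L)) = (\<lambda>i\<in>J. p i)"
    "join (balg_prod J L) p (bzero (balg_prod J L)) = (\<lambda>i\<in>J. p i)"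
    using pi assms by (auto simp: balg_prod_def ax intro!: restrict_ext)
  then show "meet (balg_prod J L) p (bone (balg_prod J L)) = p"
    "join (balg_prod J L) p (bzero (balg_prod J L)) = p"
    using pe by simp_all
  show "meet (balg_prod J L) p (compl (balg_prod J L) p) = bzero (balg_prod J L)"
    "join (balg_prod J L) p (compl (balg_prod J L) p) = bone (balg_prod J L)"
    using pi assms by (auto simp: balg_prod_def ax intro!: restrict_ext)
  assume q: "q \<in> carrier (balg_prod J L)"
  then have qi: "\<And>i. i \<in> J \<Longrightarrow> q i \<in> carrier (L i)" by (auto simp: balg_prod_def)
  show "meet (balg_prod J L) p q \<in> carrier (balg_prod J L)"
    "join (balg_prod J L) p q \<in> carrier (balg_prod J L)"
    using pi qi assms by (auto simp: balg_prod_def ax)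
  show "meet (balg_prod J L) p q = meet (balg_prod J L) q p"
    "join (balg_prod J L) p q = join (balg_prod J L) q p"
    using pi qi assms boolean_alg.meet_commute boolean_alg.join_commute
    by (fastforce simp: balg_prod_def intro!: restrict_ext)+
  assume r: "r \<in> carrier (balg_prod J L)"
  then have ri: "\<And>i. i \<in> J \<Longrightarrow> r i \<in> carrier (L i)" by (auto simp: balg_prod_def)
  show "meet (balg_prod J L) (meet (balg_prod J L) p q) r
      = meet (balg_prod J L) p (meet (balg_prod J L) q r)"
    "join (balg_prod J L) (join (balg_prod J L) p q) r
      = join (balg_prod J L) p (join (balg_prod J L) q r)"
    using pi qi ri assms by (auto simp: balg_prod_def ax intro!: restrict_ext)
  show
    "meet (balg_prod J L) p (join (balg_prod J L) q r)
      = join (balg_prod J L) (meet (balg_prod J L) p q) (meet (balg_prod J L) p r)"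
    "join (balg_prod J L) p (meet (balg_prod J L) q r)
      = meet (balg_prod J L) (join (balg_prod J L) p q) (join (balg_prod J L) p r)"
    using pi qi ri assms
    by (auto simp: balg_prod_def boolean_alg.meet_join_distrib boolean_alg.join_meet_distrib
        intro!: restrict_ext)
qed (use assms in \<open>auto simp: balg_prod_def intro: boolean_alg.bzero_closed boolean_alg.bone_closed\<close>)

lemma balg_hom_prod:
  assumes "\<And>i. i \<in> J \<Longrightarrow> balg_hom K (L i) (h i)"
  shows "balg_hom K (balg_prod J L) (\<lambda>p. \<lambda>i\<in>J. h i p)"
proof -
  have "h i \<in> carrier K \<rightarrow> carrier (L i)"
    "\<And>p q. \<lbrakk>p \<in> carrier K; q \<in> carrier K\<rbrakk> \<Longrightarrow> h i (meet K p q) = meet (L i) (h i p) (h i q)"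
    "\<And>p q. \<lbrakk>p \<in> carrier K; q \<in> carrier K\<rbrakk> \<Longrightarrow> h i (join K p q) = join (L i) (h i p) (h i q)"
    "\<And>p. p \<in> carrier K \<Longrightarrow> h i (compl K p) = compl (L i) (h i p)"
    "h i (bzero K) = bzero (L i)" "h i (bone K) = bone (L i)" if "i \<in> J" for i
    using assms[OF that] by (simp_all add: balg_hom_def)
  then show ?thesis
    by (auto simp: balg_hom_def balg_prod_def Pi_iff intro!: restrict_ext)
qed

lemma balg_le_prod:
  assumes "p \<in> carrier (balg_prod J L)" "\<And>i. i \<in> J \<Longrightarrow> balg_le (L i) (p i) (q i)"
  shows "balg_le (balg_prod J L) p q"
proof -
  have "(\<lambda>i\<in>J. p i) = p" using assms(1) by (simp add: balg_prod_def PiE_restrict)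
  then show ?thesis
    using assms(2) unfolding balg_le_def balg_prod_def
    by (metis (mono_tags, lifting) balg.select_convs(1) restrict_ext)
qed

text \<open>\<open>balg_eq\<close> and the agreement of h with g speak about the carrier only.
  Closure of L under its operations keeps every argument inside it.\<close>

lemma balg_hom_cong:
  assumes "balg_hom K M h" "balg_eq K L" "\<And>p. p \<in> carrier L \<Longrightarrow> h p = g p"
    "boolean_alg L"
  shows "balg_hom L M g"
proof -
  interpret boolean_alg L by fact
  show ?thesis
    using assms(1-3) unfolding balg_hom_def balg_eq_def
    by (simp add: Pi_iff meet_closed join_closed compl_closed bzero_closed bone_closed)
qed

section \<open>Modifications\<close>

text \<open>
  The convention that a theory is nontrivial survives a change of the component at the empty set
  because non-closedness can always be detected by substitutions into nonempty sets of variables: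
  an element \<open>p\<close> closed with respect to these satisfies \<open>p\<rho> = p\<kappa>\<eta>\<close>, where
  \<open>\<kappa>\<close> maps everything to one variable, which can moreover be exchanged for another one.
\<close>

lemma (in quantifier_theory) nonempty_target_nontrivial:
  "\<exists>X\<in>S. X \<noteq> {} \<and> (\<exists>p\<in>carrier (fms A X). \<exists>Y\<in>S. Y \<noteq> {} \<and>
    (\<exists>\<sigma>\<in>X \<rightarrow>\<^sub>E tms A Y. \<exists>\<tau>\<in>X \<rightarrow>\<^sub>E tms A Y. psub A X Y p \<sigma> \<noteq> psub A X Y p \<tau>))"
proof (rule ccontr)
  assume contra: "\<not> ?thesis"
  have closed: "psub A X Y p \<sigma> = psub A X Y p \<tau>"
    if "X \<in> S" "X \<noteq> {}" "p \<in> carrier (fms A X)" "Y \<in> S" "Y \<noteq> {}"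
      "\<sigma> \<in> X \<rightarrow>\<^sub>E tms A Y" "\<tau> \<in> X \<rightarrow>\<^sub>E tms A Y" for X Y p \<sigma> \<tau>
    by (rule ccontr, rule notE[OF contra])
      (intro bexI[of _ X] bexI[of _ p] bexI[of _ Y] bexI[of _ \<sigma>] bexI[of _ \<tau>] conjI that)
  obtain X p where X: "X \<in> S" "X \<noteq> {}" and p: "p \<in> carrier (fms A X)"
    and open_p: "\<not> formula_support S A X p {}"
    using nontrivial by blast
  have "\<exists>\<rho>\<in>X \<rightarrow>\<^sub>E tms0 A. \<exists>\<rho>'\<in>X \<rightarrow>\<^sub>E tms0 A. {} \<in> S \<and> psub0 A X p \<rho> \<noteq> psub0 A X p \<rho>'"
  proof (rule ccontr)
    assume none: "\<not> ?thesis"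
    have "formula_support S A X p {}"
      unfolding formula_support_def
    proof (intro conjI ballI impI)
      fix Y \<sigma> \<tau>
      assume "Y \<in> S" "Y \<noteq> {}" "\<sigma> \<in> X \<rightarrow>\<^sub>E tms A Y" "\<tau> \<in> X \<rightarrow>\<^sub>E tms A Y"
      then show "psub A X Y p \<sigma> = psub A X Y p \<tau>" by (rule closed[OF X p])
    next
      fix \<rho> \<rho>'
      assume "{} \<in> S" "\<rho> \<in> X \<rightarrow>\<^sub>E tms0 A" "\<rho>' \<in> X \<rightarrow>\<^sub>E tms0 A"
      with none show "psub0 A X p \<rho> = psub0 A X p \<rho>'" by blast
    qed simp
    with open_p show False by simp
  qed
  then obtain \<rho> \<rho>' where E: "{} \<in> S" and \<rho>: "\<rho> \<in> X \<rightarrow>\<^sub>E tms0 A" "\<rho>' \<in> X \<rightarrow>\<^sub>E tms0 A"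
    and ne: "psub0 A X p \<rho> \<noteq> psub0 A X p \<rho>'"
    by blast
  obtain x where x: "x \<in> X" using X by blast
  obtain Y where Y: "Y \<in> S" "infinite Y" using infinite_member by blast
  then obtain y z where yz: "y \<in> Y" "z \<in> Y" "y \<noteq> z"
    by (metis finite.simps insertI1 is_singletonI' is_singleton_def)
  then have Yne: "Y \<noteq> {}" by blast
  define \<kappa> where "\<kappa> W w = (\<lambda>_\<in>X. var A W w)" for W w
  have \<kappa>: "\<kappa> W w \<in> X \<rightarrow>\<^sub>E tms A W" if "W \<in> S" "w \<in> W" for W w
    using var_closed[OF that] by (auto simp: \<kappa>_def)
  have \<kappa>0: "psub0 A W (psub A X W p (\<kappa> W w)) \<eta> = psub0 A X p (\<lambda>_\<in>X. \<eta> w)"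
    if W: "W \<in> S" "w \<in> W" and \<eta>: "\<eta> \<in> W \<rightarrow>\<^sub>E tms0 A" for W w \<eta>
  proof -
    have "comp_sub0 A X W (\<kappa> W w) \<eta> = (\<lambda>_\<in>X. \<eta> w)"
      using P3_0[OF W(1) E W(2) \<eta>] by (auto simp: comp_sub0_def \<kappa>_def)
    then show ?thesis using P2_fm0[OF X W(1) _ E p \<kappa>[OF W] \<eta>] W by auto
  qed
  \<comment> \<open>Being insensitive to substitutions into nonempty sets, p is unchanged when the
    identity substitution of P1 is replaced by \<kappa>; hence evaluation at \<eta> sees only its
    value at x.\<close>
  have const: "psub0 A X p \<eta> = psub0 A X p (\<lambda>_\<in>X. \<eta> x)" if \<eta>: "\<eta> \<in> X \<rightarrow>\<^sub>E tms0 A" for \<eta>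
  proof -
    have "var_map A X \<in> X \<rightarrow>\<^sub>E tms A X" using var_closed X by (auto simp: var_map_def)
    then have "psub A X X p (\<kappa> X x) = p"
      using closed[OF X p X \<kappa>[OF X(1) x]] P1_fm[OF X p] by metis
    then show ?thesis using \<kappa>0[OF X(1) x \<eta>] by simp
  qed
  \<comment> \<open>A single map that carries \<rho> at y and \<rho>' at z. Exchanging y for z,
    which p cannot notice, turns the value at \<rho> into the value at \<rho>'.\<close>
  define \<eta> where "\<eta> = (\<lambda>w\<in>Y. if w = y then \<rho> x else \<rho>' x)"
  have \<eta>: "\<eta> \<in> Y \<rightarrow>\<^sub>E tms0 A" using \<rho> x by (auto simp: \<eta>_def PiE_iff)
  have "psub0 A X p \<rho> = psub0 A X p (\<lambda>_\<in>X. \<eta> y)"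
    using const[OF \<rho>(1)] yz by (simp add: \<eta>_def)
  also have "\<dots> = psub0 A Y (psub A X Y p (\<kappa> Y y)) \<eta>"
    using \<kappa>0[OF Y(1) yz(1) \<eta>] by simp
  also have "\<dots> = psub0 A Y (psub A X Y p (\<kappa> Y z)) \<eta>"
    using closed[OF X p Y(1) Yne \<kappa>[OF Y(1) yz(1)] \<kappa>[OF Y(1) yz(2)]] by simp
  also have "\<dots> = psub0 A X p (\<lambda>_\<in>X. \<eta> z)"
    using \<kappa>0[OF Y(1) yz(2) \<eta>] by simp
  also have "\<dots> = psub0 A X p \<rho>'"
    using const[OF \<rho>(2)] yz by (simp add: \<eta>_def)
  finally show False using ne by simp
qed

text \<open>Reduces a change of the component at the empty set to the axioms with empty target.
  Closure of formula substitution is not listed among them, since it is part of the homomorphism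
  property P4.\<close>

lemma quantifier_theory_modification:
  fixes A :: "('v, 't, 'p, 'd, 'b) qtheory" and B :: "('v, 't, 'p, 'e, 'c) qtheory"
  assumes "quantifier_theory S A"
    and eqs: "tms B = tms A" "var B = var A" "fms B = fms A" "tsub B = tsub A" "psub B = psub A"
      "qall B = qall A"
    and fms_boolean0: "boolean_alg (fms0 B)"
    and tsub_closed0: "\<And>X a \<rho>. \<lbrakk>X \<in> S; X \<noteq> {}; a \<in> tms A X; \<rho> \<in> X \<rightarrow>\<^sub>E tms0 B\<rbrakk>
      \<Longrightarrow> tsub0 B X a \<rho> \<in> tms0 B"
    and P2_tm0: "\<And>X Y a \<sigma> \<rho>. \<lbrakk>X \<in> S; X \<noteq> {}; Y \<in> S; Y \<noteq> {}; a \<in> tms A X;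
        \<sigma> \<in> X \<rightarrow>\<^sub>E tms A Y; \<rho> \<in> Y \<rightarrow>\<^sub>E tms0 B\<rbrakk>
      \<Longrightarrow> tsub0 B Y (tsub A X Y a \<sigma>) \<rho> = tsub0 B X a (comp_sub0 B X Y \<sigma> \<rho>)"
    and P2_fm0: "\<And>X Y p \<sigma> \<rho>. \<lbrakk>X \<in> S; X \<noteq> {}; Y \<in> S; Y \<noteq> {}; p \<in> carrier (fms A X);
        \<sigma> \<in> X \<rightarrow>\<^sub>E tms A Y; \<rho> \<in> Y \<rightarrow>\<^sub>E tms0 B\<rbrakk>
      \<Longrightarrow> psub0 B Y (psub A X Y p \<sigma>) \<rho> = psub0 B X p (comp_sub0 B X Y \<sigma> \<rho>)"
    and P3_0: "\<And>X x \<rho>. \<lbrakk>X \<in> S; x \<in> X; \<rho> \<in> X \<rightarrow>\<^sub>E tms0 B\<rbrakk> \<Longrightarrow> tsub0 B X (var A X x) \<rho> = \<rho> x"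
    and P4_0: "\<And>X \<rho>. \<lbrakk>X \<in> S; X \<noteq> {}; \<rho> \<in> X \<rightarrow>\<^sub>E tms0 B\<rbrakk>
      \<Longrightarrow> balg_hom (fms A X) (fms0 B) (\<lambda>p. psub0 B X p \<rho>)"
  shows "quantifier_theory (S \<union> {{}}) B"
proof -
  interpret A: quantifier_theory S A by fact
  have derived: "var_map B = var_map A" "comp_sub B = comp_sub A" "single_sub B = single_sub A"
    by (auto simp: fun_eq_iff var_map_def comp_sub_def single_sub_def eqs)
  have mem: "X \<in> S" if "X \<in> S \<union> {{}}" "X \<noteq> {}" for X using that by simp
  note eqs' = eqs derived
  show ?thesis
  proof (rule quantifier_theory.intro, unfold eqs')
    show "\<exists>X\<in>S \<union> {{}}. infinite X" using A.infinite_member by blast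
    show "\<exists>X\<in>S \<union> {{}}. X \<noteq> {} \<and>
        (\<exists>p\<in>carrier (fms A X). \<not> formula_support (S \<union> {{}}) B X p {})"
    proof -
      obtain X p Y \<sigma> \<tau> where *: "X \<in> S" "X \<noteq> {}" "p \<in> carrier (fms A X)" "Y \<in> S" "Y \<noteq> {}"
        "\<sigma> \<in> X \<rightarrow>\<^sub>E tms A Y" "\<tau> \<in> X \<rightarrow>\<^sub>E tms A Y" "psub A X Y p \<sigma> \<noteq> psub A X Y p \<tau>"
        using A.nonempty_target_nontrivial by blast
      \<comment> \<open>The separating substitutions have a nonempty target, where B and A
        coincide.\<close>
      have "\<not> formula_support (S \<union> {{}}) B X p {}"
      proof
        assume "formula_support (S \<union> {{}}) B X p {}"
        note supp = conjunct1[OF conjunct2[OF this[unfolded formula_support_def eqs]]]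
        from bspec[OF bspec[OF mp[OF bspec[OF supp UnI1[OF *(4)]] *(5)] *(6)] *(7)] *(8)
        show False by simp
      qed
      with *(1-3) show ?thesis by blast
    qed
    show "psub0 B X p \<rho> \<in> carrier (fms0 B)"
      if "X \<in> S \<union> {{}}" "X \<noteq> {}" "p \<in> carrier (fms A X)" "\<rho> \<in> X \<rightarrow>\<^sub>E tms0 B" for X p \<rho>
      using P4_0[OF mem that(2,4)] that by (auto simp: balg_hom_def)
    fix X Y x y z p \<sigma>
    assume *: "X \<in> S \<union> {{}}" "Y \<in> S \<union> {{}}" "x \<in> X" "p \<in> carrier (fms A X)"
      "\<sigma> \<in> X \<rightarrow>\<^sub>E tms A Y" "y \<in> Y" "z \<in> Y" "y \<noteq> z"
      "comp_sub A X Y Y \<sigma> (single_sub A Y (var A Y z) y) = \<sigma>"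
    then have "X \<in> S" "Y \<in> S" by auto
    with * show "psub A X Y (qall A X x p) \<sigma> = qall A Y y (psub A X Y p (\<sigma>(x := var A Y y)))"
      by (intro A.P5)
  qed (auto intro: fms_boolean0 tsub_closed0 P2_tm0 P2_fm0 P3_0 P4_0 A.var_closed A.fms_boolean
        A.tsub_closed A.psub_closed A.qall_closed A.P1_tm A.P1_fm A.P2_tm A.P2_fm A.P3 A.P4 A.Q1 A.Q2 A.Q3)
qed

text \<open>A given model agrees with A only on carriers and on admissible arguments, not as a
  record. Restating its laws at the empty set through the data of A gives the models
  \<open>Bs i\<close> a common language, in which the product can be treated componentwise.\<close>

locale modification = A: quantifier_theory S A + B: quantifier_theory "S \<union> {{}}" B
  for S :: "'v set set" and A :: "('v, 't, 'p, 'd, 'b) qtheory"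
    and B :: "('v, 't, 'p, 'e, 'c) qtheory" +
  assumes same: "same_restriction S A B"
begin

lemma same_simps:
  assumes "X \<in> S" "X \<noteq> {}"
  shows "tms B X = tms A X" "carrier (fms B X) = carrier (fms A X)"
    "x \<in> X \<Longrightarrow> var B X x = var A X x"
    "\<lbrakk>x \<in> X; p \<in> carrier (fms A X)\<rbrakk> \<Longrightarrow> qall B X x p = qall A X x p"
    "\<lbrakk>Y \<in> S; Y \<noteq> {}; \<sigma> \<in> X \<rightarrow>\<^sub>E tms A Y; a \<in> tms A X\<rbrakk> \<Longrightarrow> tsub B X Y a \<sigma> = tsub A X Y a \<sigma>"
    "\<lbrakk>Y \<in> S; Y \<noteq> {}; \<sigma> \<in> X \<rightarrow>\<^sub>E tms A Y; p \<in> carrier (fms A X)\<rbrakk>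
      \<Longrightarrow> psub B X Y p \<sigma> = psub A X Y p \<sigma>"
    "balg_eq (fms B X) (fms A X)"
proof -
  have X: "X \<in> S - {{}}" using assms by simp
  note restr = same[unfolded same_restriction_def, THEN bspec, OF X]
  note restr1 = conjunct2[OF restr] and restr2 = conjunct2[OF conjunct2[OF restr]]
  show "tms B X = tms A X" by (rule conjunct1[OF restr])
  show "balg_eq (fms B X) (fms A X)" by (rule conjunct1[OF restr2])
  then show "carrier (fms B X) = carrier (fms A X)" by (simp add: balg_eq_def)
  show "var B X x = var A X x" if "x \<in> X"
    by (rule bspec[OF conjunct1[OF restr1] that])
  show "qall B X x p = qall A X x p" if "x \<in> X" "p \<in> carrier (fms A X)"
    by (rule bspec[OF bspec[OF conjunct2[OF conjunct2[OF restr2]] that(1)] that(2)])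
  assume "Y \<in> S" "Y \<noteq> {}" and \<sigma>: "\<sigma> \<in> X \<rightarrow>\<^sub>E tms A Y"
  then have "Y \<in> S - {{}}" by simp
  note restrY = bspec[OF bspec[OF conjunct1[OF conjunct2[OF restr2]] this] \<sigma>]
  show "tsub B X Y a \<sigma> = tsub A X Y a \<sigma>" if "a \<in> tms A X"
    by (rule bspec[OF conjunct1[OF restrY] that])
  show "psub B X Y p \<sigma> = psub A X Y p \<sigma>" if "p \<in> carrier (fms A X)"
    by (rule bspec[OF conjunct2[OF restrY] that])
qed

lemma tsub0_closed:
  assumes X: "X \<in> S" "X \<noteq> {}" and a: "a \<in> tms A X" and \<rho>: "\<rho> \<in> X \<rightarrow>\<^sub>E tms0 B"
  shows "tsub0 B X a \<rho> \<in> tms0 B"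
  by (rule B.tsub_closed0) (use same_simps(1)[OF X] assms in simp_all)

lemma tsub0_tsub:
  assumes X: "X \<in> S" "X \<noteq> {}" and Y: "Y \<in> S" "Y \<noteq> {}" and a: "a \<in> tms A X"
    and \<sigma>: "\<sigma> \<in> X \<rightarrow>\<^sub>E tms A Y" and \<rho>: "\<rho> \<in> Y \<rightarrow>\<^sub>E tms0 B"
  shows "tsub0 B Y (tsub A X Y a \<sigma>) \<rho> = tsub0 B X a (comp_sub0 B X Y \<sigma> \<rho>)"
  using B.P2_tm0[OF UnI1[OF X(1)] X(2) UnI1[OF Y(1)] Y(2), of a \<sigma> \<rho>] a \<sigma> \<rho>
  unfolding same_simps(5)[OF X Y \<sigma> a] same_simps(1)[OF X] same_simps(1)[OF Y] same_simps(2)[OF X]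
  by simp

lemma psub0_psub:
  assumes X: "X \<in> S" "X \<noteq> {}" and Y: "Y \<in> S" "Y \<noteq> {}" and p: "p \<in> carrier (fms A X)"
    and \<sigma>: "\<sigma> \<in> X \<rightarrow>\<^sub>E tms A Y" and \<rho>: "\<rho> \<in> Y \<rightarrow>\<^sub>E tms0 B"
  shows "psub0 B Y (psub A X Y p \<sigma>) \<rho> = psub0 B X p (comp_sub0 B X Y \<sigma> \<rho>)"
  using B.P2_fm0[OF UnI1[OF X(1)] X(2) UnI1[OF Y(1)] Y(2), of p \<sigma> \<rho>] p \<sigma> \<rho>
  unfolding same_simps(6)[OF X Y \<sigma> p] same_simps(1)[OF X] same_simps(1)[OF Y] same_simps(2)[OF X]
  by simp

lemma tsub0_var:
  assumes "X \<in> S" "x \<in> X" "\<rho> \<in> X \<rightarrow>\<^sub>E tms0 B"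
  shows "tsub0 B X (var A X x) \<rho> = \<rho> x"
proof -
  have "var B X x = var A X x" using same_simps(3)[OF assms(1) _ assms(2)] assms(2) by blast
  then show ?thesis using B.P3_0[of X x \<rho>] assms by simp
qed

lemma psub0_hom:
  assumes "X \<in> S" "X \<noteq> {}" "\<rho> \<in> X \<rightarrow>\<^sub>E tms0 B"
  shows "balg_hom (fms A X) (fms0 B) (\<lambda>p. psub0 B X p \<rho>)"
proof (rule balg_hom_cong)
  show "balg_hom (fms B X) (fms0 B) (\<lambda>p. psub0 B X p \<rho>)"
    using B.P4_0[OF UnI1[OF assms(1)] assms(2) _ assms(3)] by simp
  show "balg_eq (fms B X) (fms A X)" by (rule same_simps(7)[OF assms(1,2)])
  show "boolean_alg (fms A X)" by (rule A.fms_boolean[OF assms(1,2)])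
qed simp

end

text \<open>Only the attainment half of M2; that the value is a lower bound comes from M2
  itself.\<close>

definition witnessing :: "'v set set \<Rightarrow> ('v, 't, 'p, 'd, 'b) qtheory \<Rightarrow> bool"
  where "witnessing S B \<longleftrightarrow> (\<forall>X\<in>S. \<forall>x\<in>X. \<forall>p\<in>carrier (fms B X). \<forall>\<sigma>\<in>X \<rightarrow>\<^sub>E tms0 B.
    \<exists>d\<in>tms0 B. psub0 B X p (\<sigma>(x := d)) = psub0 B X (qall B X x p) \<sigma>)"

lemma fun_upd_PiE:
  "\<lbrakk>\<sigma> \<in> X \<rightarrow>\<^sub>E T; x \<in> X; d \<in> T\<rbrakk> \<Longrightarrow> \<sigma>(x := d) \<in> X \<rightarrow>\<^sub>E T"
  using PiE_fun_upd[of d "\<lambda>_. T" x \<sigma> X] by (simp add: insert_absorb)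

lemma (in two_model) witnessing: "witnessing S B"
  unfolding witnessing_def
proof (intro ballI)
  fix X x p \<sigma>
  assume *: "X \<in> S" "x \<in> X" "p \<in> carrier (fms B X)" "\<sigma> \<in> X \<rightarrow>\<^sub>E tms0 B"
  let ?D = "(\<lambda>d. psub0 B X p (\<sigma>(x := d))) ` tms0 B"
  interpret L: boolean_alg "fms0 B" using fms_boolean0 empty_member by simp
  have X: "X \<noteq> {}" using *(2) by blast
  have "\<sigma>(x := d) \<in> X \<rightarrow>\<^sub>E tms0 B" if "d \<in> tms0 B" for d
    by (rule fun_upd_PiE[OF *(4,2) that])
  then have "?D \<subseteq> carrier (fms0 B)"
    using psub_closed0[OF *(1) X empty_member *(3)] by (simp add: image_subset_iff)
  moreover have "?D \<noteq> {}" using M1_tm by simp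
  ultimately have "psub0 B X (qall B X x p) \<sigma> \<in> ?D"
    by (rule L.two_element_inf_attained[OF fms0_two _ _ M2[OF *]])
  then obtain d where "d \<in> tms0 B" "psub0 B X (qall B X x p) \<sigma> = psub0 B X p (\<sigma>(x := d))"
    by (rule imageE)
  then show "\<exists>d\<in>tms0 B. psub0 B X p (\<sigma>(x := d)) = psub0 B X (qall B X x p) \<sigma>"
    by (intro bexI) (rule sym)
qed

section \<open>Quotients by ultrafilters\<close>

text \<open>Valid for any model with witnesses: they turn the infimum of M2 into a least instance,
  which the quotient map preserves.\<close>

lemma (in quantifier_model) two_model_quot:
  assumes wit: "witnessing S B" and ultra: "balg_ultrafilter (fms0 B) F"
  shows "two_model S (quot_modification B F)"
proof -
  let ?Q = "quot_modification B F"
  \<comment> \<open>Theories with an exchanged component are obtained over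
    \<open>S \<union> {{}}\<close>; here the empty set already belongs to S, and its old component
    is replaced.\<close>
  have SE: "S \<union> {{}} = S" using empty_member by blast
  interpret U: boolean_ultrafilter "fms0 B" F
    by (intro boolean_ultrafilter.intro boolean_ultrafilter_axioms.intro
        fms_boolean0[OF empty_member] ultra)
  have fields: "tms ?Q = tms B" "var ?Q = var B" "fms ?Q = fms B" "tsub ?Q = tsub B"
      "psub ?Q = psub B" "qall ?Q = qall B" "tms0 ?Q = tms0 B" "tsub0 ?Q = tsub0 B"
      "fms0 ?Q = balg_quot (fms0 B) F"
      "psub0 ?Q = (\<lambda>X p \<sigma>. filter_class (fms0 B) F (psub0 B X p \<sigma>))"
    by (simp_all add: quot_modification_def)
  have comp0: "comp_sub0 ?Q = comp_sub0 B"
    by (simp add: fun_eq_iff comp_sub0_def fields)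
  interpret Q: quantifier_theory S ?Q
  proof (subst SE[symmetric],
      rule quantifier_theory_modification[OF quantifier_theory_axioms fields(1-6)];
      (unfold fields comp0)?)
    show "boolean_alg (balg_quot (fms0 B) F)" by (rule U.boolean_alg_quot)
    show "balg_hom (fms B X) (balg_quot (fms0 B) F)
        (\<lambda>p. filter_class (fms0 B) F (psub0 B X p \<rho>))"
      if "X \<in> S" "X \<noteq> {}" "\<rho> \<in> X \<rightarrow>\<^sub>E tms0 B" for X \<rho>
      by (rule balg_hom_comp[OF P4_0[OF that(1,2) empty_member that(3)] U.balg_hom_quot])
  qed (simp_all add: tsub_closed0 P2_tm0 P2_fm0 P3_0 empty_member)
  show ?thesis
  proof (unfold_locales, unfold fields)
    fix X x p \<sigma>
    assume *: "X \<in> S" "x \<in> X" "p \<in> carrier (fms B X)" "\<sigma> \<in> X \<rightarrow>\<^sub>E tms0 B"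
    let ?h = "filter_class (fms0 B) F" and ?f = "\<lambda>d. psub0 B X p (\<sigma>(x := d))"
    have X: "X \<noteq> {}" using *(2) by blast
    have closed: "?f ` tms0 B \<subseteq> carrier (fms0 B)"
      using psub_closed0[OF *(1) X empty_member *(3)] fun_upd_PiE[OF *(4,2)]
      by (simp add: image_subset_iff)
    obtain d where "d \<in> tms0 B" "?f d = psub0 B X (qall B X x p) \<sigma>"
      using wit * unfolding witnessing_def by blast
    then have "psub0 B X (qall B X x p) \<sigma> \<in> ?f ` tms0 B" by (metis imageI)
    \<comment> \<open>The domain is unchanged, so the instances in the quotient are exactly the
      images of the instances in B.\<close>
    from balg_is_inf_hom_image[OF M2[OF *] this closed U.balg_hom_quot]
    show "balg_is_inf (balg_quot (fms0 B) F) ((\<lambda>d. ?h (?f d)) ` tms0 B)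
        (?h (psub0 B X (qall B X x p) \<sigma>))"
      by (simp add: image_image)
  qed (rule empty_member M1_tm U.quot_nontrivial U.quot_two)+
qed

section \<open>Products of 2-models\<close>

text \<open>Both claims rest on the same tuple of witnesses: a lower bound that is itself an
  instance is the infimum.\<close>

lemma
  fixes A :: "('v, 't, 'p, 'd, 'b) qtheory" and Bs :: "'i \<Rightarrow> ('v, 't, 'p, 'e, 'c) qtheory"
  assumes J: "J \<noteq> {}" and A: "quantifier_theory S A"
    and Bs: "\<And>i. i \<in> J \<Longrightarrow> two_model_of S A (Bs i)"
  shows quantifier_model_prod: "quantifier_model (S \<union> {{}}) (prod_modification A J Bs)"
    and witnessing_prod: "witnessing (S \<union> {{}}) (prod_modification A J Bs)"
proof -
  let ?B = "prod_modification A J Bs"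
  define proj where "proj X \<sigma> i = (\<lambda>x\<in>X. \<sigma> x i)" for X :: "'v set" and \<sigma> :: "'v \<Rightarrow> 'i \<Rightarrow> 'e" and i
  interpret A: quantifier_theory S A by fact
  have fields: "tms ?B = tms A" "var ?B = var A" "fms ?B = fms A" "tsub ?B = tsub A"
      "psub ?B = psub A" "qall ?B = qall A" "tms0 ?B = (\<Pi>\<^sub>E i\<in>J. tms0 (Bs i))"
      "fms0 ?B = balg_prod J (\<lambda>i. fms0 (Bs i))"
      "tsub0 ?B = (\<lambda>X a \<sigma>. \<lambda>i\<in>J. tsub0 (Bs i) X a (proj X \<sigma> i))"
      "psub0 ?B = (\<lambda>X p \<sigma>. \<lambda>i\<in>J. psub0 (Bs i) X p (proj X \<sigma> i))"
    by (simp_all add: prod_modification_def proj_def)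
  have two: "two_model (S \<union> {{}}) (Bs i)" and same: "same_restriction S A (Bs i)" if "i \<in> J" for i
    using Bs[OF that] by (simp_all add: two_model_of_def)
  have model: "quantifier_model (S \<union> {{}}) (Bs i)" if "i \<in> J" for i
    using two[OF that] by (rule two_model.axioms)
  have thy: "quantifier_theory (S \<union> {{}}) (Bs i)" if "i \<in> J" for i
    using model[OF that] by (rule quantifier_model.axioms)
  have mods: "modification S A (Bs i)" if "i \<in> J" for i
    by (intro modification.intro modification_axioms.intro A thy same that)
  have proj: "proj X \<sigma> i \<in> X \<rightarrow>\<^sub>E tms0 (Bs i)"
    if "i \<in> J" "\<sigma> \<in> X \<rightarrow>\<^sub>E (\<Pi>\<^sub>E i\<in>J. tms0 (Bs i))" for X \<sigma> i
    using that by (auto simp: proj_def PiE_iff)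
  \<comment> \<open>Projection commutes with composition of substitutions, so P2 holds in the
    product as soon as it holds in each component.\<close>
  have proj_comp: "proj X (comp_sub0 ?B X Y \<sigma> \<rho>) i = comp_sub0 (Bs i) X Y \<sigma> (proj Y \<rho> i)"
    if "i \<in> J" for X Y \<sigma> \<rho> i
    using that by (simp add: proj_def[of X] comp_sub0_def fields fun_eq_iff restrict_def)
  have theory_prod: "quantifier_theory (S \<union> {{}}) ?B"
  proof (rule quantifier_theory_modification[OF A fields(1-6)])
    show "boolean_alg (fms0 ?B)"
      unfolding fields
      by (rule boolean_alg_prod) (rule quantifier_theory.fms_boolean0[OF thy], simp_all)
    show "tsub0 ?B X a \<rho> \<in> tms0 ?B"
      if "X \<in> S" "X \<noteq> {}" "a \<in> tms A X" "\<rho> \<in> X \<rightarrow>\<^sub>E tms0 ?B" for X a \<rho>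
      using modification.tsub0_closed[OF mods that(1-3) proj] that(4)
      by (simp add: fields)
    show "tsub0 ?B Y (tsub A X Y a \<sigma>) \<rho> = tsub0 ?B X a (comp_sub0 ?B X Y \<sigma> \<rho>)"
      if "X \<in> S" "X \<noteq> {}" "Y \<in> S" "Y \<noteq> {}" "a \<in> tms A X" "\<sigma> \<in> X \<rightarrow>\<^sub>E tms A Y"
        "\<rho> \<in> Y \<rightarrow>\<^sub>E tms0 ?B" for X Y a \<sigma> \<rho>
      using modification.tsub0_tsub[OF mods that(1-6) proj] that(7)
      by (simp add: fields proj_comp cong: restrict_cong)
    show "psub0 ?B Y (psub A X Y p \<sigma>) \<rho> = psub0 ?B X p (comp_sub0 ?B X Y \<sigma> \<rho>)"
      if "X \<in> S" "X \<noteq> {}" "Y \<in> S" "Y \<noteq> {}" "p \<in> carrier (fms A X)" "\<sigma> \<in> X \<rightarrow>\<^sub>E tms A Y"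
        "\<rho> \<in> Y \<rightarrow>\<^sub>E tms0 ?B" for X Y p \<sigma> \<rho>
      using modification.psub0_psub[OF mods that(1-6) proj] that(7)
      by (simp add: fields proj_comp cong: restrict_cong)
    show "tsub0 ?B X (var A X x) \<rho> = \<rho> x"
      if "X \<in> S" "x \<in> X" "\<rho> \<in> X \<rightarrow>\<^sub>E tms0 ?B" for X x \<rho>
    proof -
      have "\<rho> x \<in> (\<Pi>\<^sub>E i\<in>J. tms0 (Bs i))" using that(2,3) unfolding fields by (rule PiE_mem[rotated])
      then have "(\<lambda>i\<in>J. \<rho> x i) = \<rho> x" by (rule PiE_restrict)
      moreover have "tsub0 (Bs i) X (var A X x) (proj X \<rho> i) = \<rho> x i" if i: "i \<in> J" for i
        using modification.tsub0_var[OF mods[OF i] \<open>X \<in> S\<close> \<open>x \<in> X\<close> proj[OF i]]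
          \<open>x \<in> X\<close> \<open>\<rho> \<in> X \<rightarrow>\<^sub>E tms0 ?B\<close>
        by (simp add: fields proj_def)
      ultimately show ?thesis by (simp add: fields cong: restrict_cong)
    qed
    show "balg_hom (fms A X) (fms0 ?B) (\<lambda>p. psub0 ?B X p \<rho>)"
      if "X \<in> S" "X \<noteq> {}" "\<rho> \<in> X \<rightarrow>\<^sub>E tms0 ?B" for X \<rho>
      unfolding fields
      by (rule balg_hom_prod, rule modification.psub0_hom[OF mods that(1,2) proj])
        (use that(3) in \<open>simp_all add: fields\<close>)
  qed
  then interpret B: quantifier_theory "S \<union> {{}}" ?B .
  have attained: "\<exists>d\<in>tms0 ?B. psub0 ?B X p (\<sigma>(x := d)) = psub0 ?B X (qall ?B X x p) \<sigma>"
    and lower: "\<forall>d\<in>tms0 ?B. balg_le (fms0 ?B) (psub0 ?B X (qall ?B X x p) \<sigma>)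
      (psub0 ?B X p (\<sigma>(x := d)))"
    if "X \<in> S \<union> {{}}" "x \<in> X" "p \<in> carrier (fms ?B X)" "\<sigma> \<in> X \<rightarrow>\<^sub>E tms0 ?B" for X x p \<sigma>
  proof -
    have X: "X \<in> S" "X \<noteq> {}" using that(1,2) by auto
    have p: "p \<in> carrier (fms A X)" using that(3) by (simp add: fields)
    have p': "p \<in> carrier (fms (Bs i) X)" and qall: "qall (Bs i) X x p = qall A X x p"
      if "i \<in> J" for i
      using modification.same_simps(2,4)[OF mods[OF that] X] p \<open>x \<in> X\<close> by simp_all
    have \<sigma>: "proj X \<sigma> i \<in> X \<rightarrow>\<^sub>E tms0 (Bs i)" if "i \<in> J" for i
      using proj[OF that] \<open>\<sigma> \<in> X \<rightarrow>\<^sub>E tms0 ?B\<close> by (simp add: fields)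
    \<comment> \<open>Component i of the instance at the tuple d is thus the instance at
      \<open>d i\<close> in \<open>Bs i\<close>.\<close>
    have upd: "proj X (\<sigma>(x := d)) i = (proj X \<sigma> i)(x := d i)" for d i
      using that(2) by (auto simp: proj_def)
    \<comment> \<open>Witnesses can be chosen independently for each index because the domain is the
      full product: any tuple of them is again an element.\<close>
    have "\<forall>i\<in>J. \<exists>e. e \<in> tms0 (Bs i) \<and>
        psub0 (Bs i) X p ((proj X \<sigma> i)(x := e)) = psub0 (Bs i) X (qall A X x p) (proj X \<sigma> i)"
      using two_model.witnessing[OF two, unfolded witnessing_def] that(1,2) p' \<sigma> qall by fastforce
    then obtain e where e: "\<And>i. i \<in> J \<Longrightarrow> e i \<in> tms0 (Bs i)"
      "\<And>i. i \<in> J \<Longrightarrow> psub0 (Bs i) X p ((proj X \<sigma> i)(x := e i))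
        = psub0 (Bs i) X (qall A X x p) (proj X \<sigma> i)"
      by (auto dest!: bchoice)
    show "\<exists>d\<in>tms0 ?B. psub0 ?B X p (\<sigma>(x := d)) = psub0 ?B X (qall ?B X x p) \<sigma>"
      by (rule bexI[of _ "\<lambda>i\<in>J. e i"]) (simp_all add: fields upd e cong: restrict_cong)
    show "\<forall>d\<in>tms0 ?B. balg_le (fms0 ?B) (psub0 ?B X (qall ?B X x p) \<sigma>)
      (psub0 ?B X p (\<sigma>(x := d)))"
    proof
      fix d assume d: "d \<in> tms0 ?B"
      have C: "psub0 ?B X (qall ?B X x p) \<sigma> \<in> carrier (fms0 ?B)"
        by (rule B.psub_closed0[OF that(1) X(2) _ B.qall_closed[OF that(1-3)] that(4)]) simp
      have "balg_le (fms0 (Bs i)) (psub0 (Bs i) X (qall A X x p) (proj X \<sigma> i))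
          (psub0 (Bs i) X p ((proj X \<sigma> i)(x := d i)))" if i: "i \<in> J" for i
      proof -
        have "d i \<in> tms0 (Bs i)" using d i by (auto simp: fields)
        then show ?thesis
          using quantifier_model.M2[OF model[OF i] \<open>X \<in> S \<union> {{}}\<close> \<open>x \<in> X\<close> p'[OF i] \<sigma>[OF i]]
          by (auto simp: balg_is_inf_def qall[OF i])
      qed
      then show "balg_le (fms0 ?B) (psub0 ?B X (qall ?B X x p) \<sigma>) (psub0 ?B X p (\<sigma>(x := d)))"
        using balg_le_prod[OF C[unfolded fields]] unfolding fields by (simp add: upd)
    qed
  qed
  show "witnessing (S \<union> {{}}) ?B"
    unfolding witnessing_def using attained by simp
  show "quantifier_model (S \<union> {{}}) ?B"
  proof
    show "{} \<in> S \<union> {{}}" by simp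
    show "tms0 ?B \<noteq> {}"
      using quantifier_model.M1_tm[OF model] by (simp add: fields PiE_eq_empty_iff)
    \<comment> \<open>A product over no indices would be the one-element algebra; a single index
      already separates 0 from 1.\<close>
    obtain i where i: "i \<in> J" using J by blast
    have "bzero (fms0 ?B) i \<noteq> bone (fms0 ?B) i"
      using quantifier_model.M1_fm[OF model[OF i]] i by (simp add: fields balg_prod_def)
    then show "bzero (fms0 ?B) \<noteq> bone (fms0 ?B)" by metis
  next
    fix X x p \<sigma>
    assume *: "X \<in> S \<union> {{}}" "x \<in> X" "p \<in> carrier (fms ?B X)" "\<sigma> \<in> X \<rightarrow>\<^sub>E tms0 ?B"
    then have X: "X \<noteq> {}" by blast
    obtain d where "d \<in> tms0 ?B" "psub0 ?B X p (\<sigma>(x := d)) = psub0 ?B X (qall ?B X x p) \<sigma>"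
      using attained[OF *] by blast
    then have "psub0 ?B X (qall ?B X x p) \<sigma> \<in> (\<lambda>d. psub0 ?B X p (\<sigma>(x := d))) ` tms0 ?B"
      by (metis imageI)
    moreover have "psub0 ?B X (qall ?B X x p) \<sigma> \<in> carrier (fms0 ?B)"
      by (rule B.psub_closed0[OF *(1) X _ B.qall_closed[OF *(1-3)] *(4)]) simp
    ultimately show "balg_is_inf (fms0 ?B) ((\<lambda>d. psub0 ?B X p (\<sigma>(x := d))) ` tms0 ?B)
        (psub0 ?B X (qall ?B X x p) \<sigma>)"
      by (rule attained_inf) (use lower[OF *] in \<open>simp add: image_iff\<close>, blast)
  qed
qed

theorem theorem35:
  fixes J :: "'i set"
    and S :: "'v set set"
    and A :: "('v, 't, 'p, 'd, 'b) qtheory"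
    and Bs :: "'i \<Rightarrow> ('v, 't, 'p, 'e, 'c) qtheory"
  assumes "J \<noteq> {}"
    and "quantifier_theory S A"
    and "locally_finite S A"
    and "\<And>i. i \<in> J \<Longrightarrow> two_model_of S A (Bs i)"
  shows "model_of S A (prod_modification A J Bs) \<and>
    (\<forall>F. balg_ultrafilter (fms0 (prod_modification A J Bs)) F \<longrightarrow>
      two_model_of S A (quot_modification (prod_modification A J Bs) F))"
proof -
  let ?B = "prod_modification A J Bs"
  have model: "quantifier_model (S \<union> {{}}) ?B" and wit: "witnessing (S \<union> {{}}) ?B"
    by (rule quantifier_model_prod[OF assms(1,2,4)] witnessing_prod[OF assms(1,2,4)], assumption)+
  \<comment> \<open>Product and quotient both leave the fields for nonempty sets of variables
    exactly as they are in A.\<close>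
  have "same_restriction S A ?B"
    by (simp add: same_restriction_def balg_eq_def prod_modification_def)
  moreover have "same_restriction S A (quot_modification ?B F)" for F
    by (simp add: same_restriction_def balg_eq_def prod_modification_def quot_modification_def)
  ultimately show ?thesis
    using model quantifier_model.two_model_quot[OF model wit]
    by (simp add: model_of_def two_model_of_def)
qed

end
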